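(* Let $d \ge 2$ be an integer and let $f, f'$ be binary strings of length $d-1$. Then $\nu(f) = \nu(f')$ if and only if $Q_d(f) \cong Q_d(f')$.
   Context: A binary string of length $n$ is an element of $\{0,1\}^n$. A block of a binary string is a maximal run of consecutive equal bits. For a binary string $f = f_1 f_2\cdots f_n$, $\nu(f)$ denotes one less than the number of blocks of $f$; equivalently, $\nu(f)$ is the number of indices $i \in \{2,\ldots,n\}$ with $f_{i-1} \ne f_i$. For example, $\nu(0110) = 2$. The $d$-cube $Q_d$ is the graph whose vertices are the binary strings of length $d$, with two vertices adjacent if and only if the strings differ in exactly one position. For a binary string $f$, the generalized Fibonacci cube $Q_d(f)$ is the subgraph of $Q_d$ induced by the set of all strings of length $d$ that do not contain $f$ as a consecutive (contiguous) substring. $G \cong H$ means that the graphs $G$ and $H$ are isomorphic. *)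

theory Defs
  imports "Graph_Theory.Graph_Theory" "HOL-Library.Sublist"
begin

text \<open>Binary strings are boolean lists, indexed from 0. A run is represented by its set of
  positions.\<close>

definition is_run :: "bool list \<Rightarrow> nat set \<Rightarrow> bool" where
  "is_run f I \<longleftrightarrow> (\<exists>i j. I = {i..<j} \<and> i < j \<and> j \<le> length f) \<and>
     (\<forall>k\<in>I. \<forall>l\<in>I. f ! k = f ! l)"

definition blocks :: "bool list \<Rightarrow> nat set set" where
  "blocks f = {I. is_run f I \<and> (\<forall>J. is_run f J \<longrightarrow> I \<subseteq> J \<longrightarrow> J = I)}"

text \<open>For the empty string the truncated subtraction yields 0.\<close>

definition nu :: "bool list \<Rightarrow> nat" where
  "nu f = card (blocks f) - 1"

text \<open>Undirected simple graphs are symmetric, loop-free pair digraphs: each edge is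
  represented by its two opposite arcs.\<close>

definition hypercube :: "nat \<Rightarrow> bool list pair_pre_digraph" where
  "hypercube d = \<lparr> pverts = {w. length w = d},
     parcs = {(u, v). length u = d \<and> length v = d \<and> (\<exists>!i. i < d \<and> u ! i \<noteq> v ! i)} \<rparr>"

definition fibonacci_cube ::
    "nat \<Rightarrow> bool list \<Rightarrow> (bool list, bool list \<times> bool list) pre_digraph" where
  "fibonacci_cube d f =
     with_proj (hypercube d) \<restriction> {w \<in> pverts (hypercube d). \<not> sublist f w}"

lemma pair_graph_hypercube: "pair_graph (hypercube d)"
proof -
  have fin: "finite {w :: bool list. length w = d}"
    using finite_lists_length_eq[of "UNIV :: bool set" d] by simp
  have "parcs (hypercube d) \<subseteq> {w. length w = d} \<times> {w. length w = d}"
    by (auto simp: hypercube_def)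
  then have fina: "finite (parcs (hypercube d))"
    using fin by (meson finite_SigmaI finite_subset)
  have sy: "sym (parcs (hypercube d))"
    by (auto simp: hypercube_def sym_def)
  show ?thesis
  proof unfold_locales
    show "finite (pverts (hypercube d))" using fin by (simp add: hypercube_def)
    show "finite (parcs (hypercube d))" by (rule fina)
    show "symmetric (with_proj (hypercube d))" using sy by (simp add: symmetric_def)
  next
    fix e assume "e \<in> parcs (hypercube d)"
    then show "fst e \<in> pverts (hypercube d)" "snd e \<in> pverts (hypercube d)"
      by (simp_all add: hypercube_def case_prod_beta)
  next
    fix e assume "e \<in> parcs (hypercube d)"
    then have "\<exists>i. fst e ! i \<noteq> snd e ! i"
      unfolding hypercube_def by (simp add: case_prod_beta) blast
    then show "fst e \<noteq> snd e" by metis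
  qed
qed

lemma graph_fibonacci_cube: "graph (fibonacci_cube d f)"
proof -
  interpret pair_graph "hypercube d" by (rule pair_graph_hypercube)
  have ind: "induced_subgraph (fibonacci_cube d f) (with_proj (hypercube d))"
    unfolding fibonacci_cube_def by (rule induced_induce) auto
  interpret S: sym_digraph "fibonacci_cube d f"
    by (rule induced_graph_imp_graph[OF ind])
  have v: "finite (verts (fibonacci_cube d f))"
    using finite_verts by (simp add: fibonacci_cube_def)
  have a: "finite (arcs (fibonacci_cube d f))"
    using finite_arcs by (simp add: fibonacci_cube_def)
  show ?thesis
  proof unfold_locales
    fix e assume "e \<in> arcs (fibonacci_cube d f)"
    then show "tail (fibonacci_cube d f) e \<noteq> head (fibonacci_cube d f) e"
      using no_loops[of e] by (simp add: fibonacci_cube_def)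
  next
    fix e1 e2
    assume "arc_to_ends (fibonacci_cube d f) e1 = arc_to_ends (fibonacci_cube d f) e2"
    then show "e1 = e2"
      by (simp add: fibonacci_cube_def arc_to_ends_def prod_eq_iff)
  qed (rule v a)+
qed

text \<open>A block is determined by its first position, and a position starts a block iff it is
  the first one or its bit differs from the previous bit.\<close>

lemma is_run_interval:
  "is_run f {i..<j} \<longleftrightarrow> i < j \<and> j \<le> length f \<and> (\<forall>k\<in>{i..<j}. f ! k = f ! i)"
proof
  assume r: "is_run f {i..<j}"
  then obtain i' j' where e: "{i..<j} = {i'..<j'}" "i' < j'" "j' \<le> length f"
    by (auto simp: is_run_def)
  then have "{i..<j} \<noteq> {}" by simp
  then have lt: "i < j" by (simp only: atLeastLessThan_empty_iff) simp
  then have "j = j'" using e atLeastLessThan_eq_iff by blast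
  with lt e have "i < j" "j \<le> length f" by simp_all
  moreover have "f ! k = f ! i" if "k \<in> {i..<j}" for k
    using r lt that unfolding is_run_def by (meson atLeastLessThan_iff order_refl)
  ultimately show "i < j \<and> j \<le> length f \<and> (\<forall>k\<in>{i..<j}. f ! k = f ! i)"
    by blast
next
  assume a: "i < j \<and> j \<le> length f \<and> (\<forall>k\<in>{i..<j}. f ! k = f ! i)"
  then have "f ! k = f ! l" if "k \<in> {i..<j}" "l \<in> {i..<j}" for k l
    using that by metis
  with a show "is_run f {i..<j}"
    unfolding is_run_def by blast
qed

lemma is_runE:
  assumes "is_run f I"
  obtains i j where "I = {i..<j}" "i < j" "j \<le> length f"
  using assms by (auto simp: is_run_def)

lemma blocks_is_run: "I \<in> blocks f \<Longrightarrow> is_run f I"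
  by (simp add: blocks_def)

lemma blocks_maximal: "I \<in> blocks f \<Longrightarrow> is_run f J \<Longrightarrow> I \<subseteq> J \<Longrightarrow> J = I"
  by (simp add: blocks_def)

lemma Min_interval: "i < j \<Longrightarrow> Min {i..<j} = i" for i j :: nat
  by (rule Min_eqI) auto

lemma bij_betw_Min_blocks:
  "bij_betw Min (blocks f) {i. i < length f \<and> (i = 0 \<or> f ! (i - 1) \<noteq> f ! i)}"
proof (rule bij_betw_imageI)
  show "inj_on Min (blocks f)"
  proof (rule inj_onI)
    fix I J assume I: "I \<in> blocks f" and J: "J \<in> blocks f" and eq: "Min I = Min J"
    obtain i j where ij: "I = {i..<j}" "i < j" "j \<le> length f"
      using blocks_is_run[OF I] by (rule is_runE)
    obtain k l where kl: "J = {k..<l}" "k < l" "l \<le> length f"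
      using blocks_is_run[OF J] by (rule is_runE)
    have "i = k" using eq ij kl by (simp add: Min_interval)
    then have "I \<subseteq> J \<or> J \<subseteq> I" using ij kl by auto
    then show "I = J" using I J by (metis blocks_is_run blocks_maximal)
  qed
  show "Min ` blocks f = {i. i < length f \<and> (i = 0 \<or> f ! (i - 1) \<noteq> f ! i)}" (is "_ = ?S")
  proof
    show "Min ` blocks f \<subseteq> ?S"
    proof (rule image_subsetI)
      fix I assume I: "I \<in> blocks f"
      obtain i j where ij: "I = {i..<j}" "i < j" "j \<le> length f"
        using blocks_is_run[OF I] by (rule is_runE)
      have const: "f ! k = f ! i" if "k \<in> {i..<j}" for k
        using blocks_is_run[OF I] that unfolding ij(1) is_run_interval by blast
      have "f ! (i - 1) \<noteq> f ! i" if "i > 0"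
      proof
        assume e: "f ! (i - 1) = f ! i"
        have "f ! k = f ! (i - 1)" if "k \<in> {i - 1..<j}" for k
        proof (cases "k = i - 1")
          case False
          then have "k \<in> {i..<j}" using that by simp linarith
          then show ?thesis using const e by metis
        qed simp
        then have "is_run f {i - 1..<j}"
          unfolding is_run_interval using ij(2,3) by (meson diff_le_self le_less_trans)
        moreover have "I \<subseteq> {i - 1..<j}" using ij by auto
        ultimately have "{i - 1..<j} = I"
          using blocks_maximal[OF I] by blast
        moreover have "i - 1 \<in> {i - 1..<j}" "i - 1 \<notin> I" using ij \<open>i > 0\<close> by simp_all
        ultimately show False by blast
      qed
      then show "Min I \<in> ?S" using ij by (auto simp: Min_interval)
    qed
    show "?S \<subseteq> Min ` blocks f"
    proof
      fix i assume i: "i \<in> ?S"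
      define j where "j = (GREATEST j. is_run f {i..<j})"
      have bd: "j' \<le> length f" if "is_run f {i..<j'}" for j'
        using that by (simp add: is_run_interval)
      have "is_run f {i..<Suc i}" using i unfolding is_run_interval by (auto simp: less_Suc_eq)
      then have run: "is_run f {i..<j}"
        unfolding j_def by (rule GreatestI_nat) (use bd in blast)
      have great: "j' \<le> j" if "is_run f {i..<j'}" for j'
        unfolding j_def using that by (rule Greatest_le_nat) (use bd in blast)
      have ij: "i < j" using run by (simp add: is_run_interval)
      have "{i..<j} \<in> blocks f"
        unfolding blocks_def
      proof (intro CollectI conjI allI impI run)
        fix J assume J: "is_run f J" "{i..<j} \<subseteq> J"
        obtain a b where ab: "J = {a..<b}" "a < b" "b \<le> length f"
          using J(1) by (rule is_runE)
        have le: "a \<le> i" "j \<le> b" using J(2) ab ij by auto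
        have "a = i"
        proof (rule ccontr)
          assume "a \<noteq> i"
          then have "i > 0" using le by simp
          have "i - 1 \<in> J" "i \<in> J" using \<open>a \<noteq> i\<close> le ab ij by auto
          then have "f ! (i - 1) = f ! i" using J(1) unfolding is_run_def by blast
          with i \<open>i > 0\<close> show False by simp
        qed
        then have "b \<le> j" using J(1) ab great by blast
        then show "J = {i..<j}" using ab le \<open>a = i\<close> by simp
      qed
      moreover have "Min {i..<j} = i" using ij by (rule Min_interval)
      ultimately show "i \<in> Min ` blocks f" by (metis image_eqI)
    qed
  qed
qed

lemma nu_conv_card_changes:
  "nu f = card {i. 1 \<le> i \<and> i < length f \<and> f ! (i - 1) \<noteq> f ! i}" (is "_ = card ?C")
proof (cases "f = []")
  case True
  then show ?thesis
    using bij_betw_same_card[OF bij_betw_Min_blocks[of f]] by (simp add: nu_def)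
next
  case False
  then have "{i. i < length f \<and> (i = 0 \<or> f ! (i - 1) \<noteq> f ! i)} = insert 0 ?C"
    by auto
  moreover have "finite ?C" by simp
  ultimately have "card (blocks f) = Suc (card ?C)"
    using bij_betw_same_card[OF bij_betw_Min_blocks[of f]] by simp
  then show ?thesis by (simp add: nu_def)
qed

end

theory Submission
  imports Defs
begin

text \<open>A string that is one bit longer than \<open>f\<close> contains \<open>f\<close> iff it has the form \<open>a f\<close> or \<open>f a\<close> for
  some bit \<open>a\<close>, so \<open>Q\<^sub>d(f)\<close> arises from the \<open>d\<close>-cube by deleting the vertices of two
  edges, one in the first direction and one in the last. Recording the positions where a string
  differs from \<open>f\<^sub>1 f\<close> identifies the cube with the subsets of \<open>{0, ..., d - 1}\<close>, and in these
  coordinates the deleted edges join \<open>{}\<close> to \<open>{0}\<close> and \<open>S\<close> to \<open>S \<union> {d - 1}\<close>, where \<open>S\<close> is the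
  set of positions at which \<open>f\<close> changes its bit (\<open>fibonacci_cube_iso_punctured_cube\<close>). Since \<open>S\<close>
  has \<open>\<nu>(f)\<close> elements, all of them strictly between \<open>0\<close> and \<open>d - 1\<close>, the theorem says that such a
  punctured cube determines, and up to isomorphism is determined by, the cardinality of \<open>S\<close>.

  Equal cardinalities give isomorphic graphs: permute the coordinates so that \<open>0\<close> and \<open>d - 1\<close>
  stay fixed and \<open>S\<close> goes to \<open>S'\<close> (\<open>punctured_cube_holes_iso\<close>).

  Conversely, the number of walks with \<open>n\<close> steps is an invariant. By inclusion-exclusion, the
  number of walks that avoid both edges is the number of walks avoiding the first, plus the
  number avoiding the second, minus the number of all walks, plus the number of walks that meet
  both. Every term but the last is independent of \<open>S\<close>, because a translation of the cube
  takes the second edge to the one that joins \<open>{}\<close> to \<open>{d - 1}\<close>. The two edges are at Hamming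
  distance \<open>card S\<close>. So if \<open>n = card S < card S'\<close>, then some walk with \<open>n\<close> steps meets both edges for
  \<open>S\<close>, none does so for \<open>S'\<close>, and the graphs have different numbers of walks
  (\<open>punctured_cube_holes_not_iso\<close>).\<close>

section \<open>Isomorphisms and walks\<close>

text \<open>The parameter \<open>n\<close> counts steps, hence the lists have one more entry.\<close>
definition walks :: "'a pair_pre_digraph \<Rightarrow> nat \<Rightarrow> 'a list set" where
  "walks G n = {ws. length ws = Suc n \<and> set ws \<subseteq> pverts G \<and>
     successively (\<lambda>u v. (u, v) \<in> parcs G) ws}"

text \<open>When arcs are pairs of vertices, an isomorphism is just a bijection of the vertices that
  preserves adjacency in both directions: the map on arcs and the new end maps are forced. This
  lemma and the next one translate between the two views.\<close>
lemma digraph_iso_with_projI: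
  assumes wfG: "wf_digraph (with_proj G)" and wfH: "wf_digraph (with_proj H)"
    and bij: "bij_betw h (pverts G) (pverts H)"
    and arc: "\<And>u v. u \<in> pverts G \<Longrightarrow> v \<in> pverts G \<Longrightarrow>
      (u, v) \<in> parcs G \<longleftrightarrow> (h u, h v) \<in> parcs H"
  shows "digraph_iso (with_proj G) (with_proj H)"
proof -
  interpret G: wf_digraph "with_proj G" by (rule wfG)
  interpret H: wf_digraph "with_proj H" by (rule wfH)
  have endsG: "u \<in> pverts G \<and> v \<in> pverts G" if "(u, v) \<in> parcs G" for u v
    using G.wellformed[of "(u, v)"] that by simp
  have endsH: "u \<in> pverts H \<and> v \<in> pverts H" if "(u, v) \<in> parcs H" for u v
    using H.wellformed[of "(u, v)"] that by simp
  have inj: "inj_on h (pverts G)" and img: "h ` pverts G = pverts H"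
    using bij by (simp_all add: bij_betw_def)
  have arcs: "map_prod h h ` parcs G = parcs H"
  proof
    show "map_prod h h ` parcs G \<subseteq> parcs H" using endsG arc by auto
    show "parcs H \<subseteq> map_prod h h ` parcs G"
    proof
      fix e assume "e \<in> parcs H"
      moreover obtain x y where e: "e = (x, y)" by (cases e)
      ultimately obtain u v where "u \<in> pverts G" "v \<in> pverts G" "x = h u" "y = h v"
        using endsH img by blast
      with \<open>e \<in> parcs H\<close> e arc show "e \<in> map_prod h h ` parcs G"
        by (intro image_eqI[of _ _ "(u, v)"]) auto
    qed
  qed
  have "inj_on (map_prod h h) (pverts G \<times> pverts G)"
    using inj by (simp add: map_prod_inj_on)
  then have injp: "inj_on (map_prod h h) (parcs G)"
    by (rule inj_on_subset) (use endsG in auto)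
  define hom where "hom = \<lparr>iso_verts = h, iso_arcs = map_prod h h, iso_head = snd, iso_tail = fst\<rparr>"
  have "pre_digraph.digraph_isomorphism (with_proj G) hom"
    using wfG inj injp by (auto simp: pre_digraph.digraph_isomorphism_def hom_def)
  moreover have "with_proj H = app_iso hom (with_proj G)"
    using img arcs by (simp add: app_iso_def hom_def with_proj_def)
  ultimately show ?thesis unfolding digraph_iso_def by blast
qed

lemma digraph_iso_with_projE:
  assumes "digraph_iso (with_proj G) (with_proj H)"
  obtains h where "bij_betw h (pverts G) (pverts H)"
    "\<And>u v. u \<in> pverts G \<Longrightarrow> v \<in> pverts G \<Longrightarrow>
      (u, v) \<in> parcs G \<longleftrightarrow> (h u, h v) \<in> parcs H"
proof -
  obtain hom where hom: "pre_digraph.digraph_isomorphism (with_proj G) hom"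
    and H: "with_proj H = app_iso hom (with_proj G)"
    using assms by (auto simp: digraph_iso_def)
  define h where "h = iso_verts hom"
  have wf: "wf_digraph (with_proj G)" and inj: "inj_on h (pverts G)"
    and ends: "\<And>a. a \<in> parcs G \<Longrightarrow>
      h (fst a) = iso_tail hom (iso_arcs hom a) \<and> h (snd a) = iso_head hom (iso_arcs hom a)"
    using hom by (auto simp: pre_digraph.digraph_isomorphism_def h_def)
  have eqs: "pverts H = h ` pverts G" "parcs H = iso_arcs hom ` parcs G"
    "iso_tail hom = fst" "iso_head hom = snd"
    using arg_cong[OF H, of verts] arg_cong[OF H, of arcs] arg_cong[OF H, of tail]
      arg_cong[OF H, of head] by (simp_all add: h_def)
  have "iso_arcs hom a = map_prod h h a" if "a \<in> parcs G" for a
    using ends[OF that] by (simp add: eqs(3,4) prod_eq_iff)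
  then have parcs: "parcs H = map_prod h h ` parcs G"
    by (simp add: eqs(2))
  have endsG: "u \<in> pverts G \<and> v \<in> pverts G" if "(u, v) \<in> parcs G" for u v
    using wf_digraph.wellformed[OF wf, of "(u, v)"] that by simp
  show ?thesis
  proof
    show "bij_betw h (pverts G) (pverts H)" using inj by (simp add: bij_betw_def eqs(1))
    show "(u, v) \<in> parcs G \<longleftrightarrow> (h u, h v) \<in> parcs H"
      if "u \<in> pverts G" "v \<in> pverts G" for u v
    proof
      show "(h u, h v) \<in> parcs H" if "(u, v) \<in> parcs G"
        unfolding parcs using that by force
      assume "(h u, h v) \<in> parcs H"
      then obtain x y where "(x, y) \<in> parcs G" "h u = h x" "h v = h y"
        unfolding parcs by auto
      then show "(u, v) \<in> parcs G"
        using endsG inj \<open>u \<in> pverts G\<close> \<open>v \<in> pverts G\<close> by (metis inj_onD)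
    qed
  qed
qed

lemma finite_walks:
  assumes "finite (pverts G)"
  shows "finite (walks G n)"
  by (rule finite_subset[OF _ finite_lists_length_eq[OF assms, of "Suc n"]])
    (auto simp: walks_def)

lemma card_walks_iso:
  assumes "digraph_iso (with_proj G) (with_proj H)"
  shows "card (walks G n) = card (walks H n)"
proof -
  obtain h where bij: "bij_betw h (pverts G) (pverts H)"
    and arc: "\<And>u v. u \<in> pverts G \<Longrightarrow> v \<in> pverts G \<Longrightarrow>
      (u, v) \<in> parcs G \<longleftrightarrow> (h u, h v) \<in> parcs H"
    using digraph_iso_with_projE[OF assms] by blast
  have inj: "inj_on h (pverts G)" and img: "h ` pverts G = pverts H"
    using bij by (simp_all add: bij_betw_def)
  have succ: "successively (\<lambda>u v. (u, v) \<in> parcs H) (map h ws) \<longleftrightarrow>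
      successively (\<lambda>u v. (u, v) \<in> parcs G) ws" if "set ws \<subseteq> pverts G" for ws
    unfolding successively_map using that arc by (intro successively_cong) auto
  have "bij_betw (map h) (walks G n) (walks H n)"
  proof (rule bij_betw_imageI)
    show "inj_on (map h) (walks G n)"
      by (rule inj_on_subset[OF inj_on_map_lists[OF inj]]) (auto simp: walks_def)
    show "map h ` walks G n = walks H n"
    proof
      show "map h ` walks G n \<subseteq> walks H n"
      proof (rule image_subsetI)
        fix ws assume "ws \<in> walks G n"
        then show "map h ws \<in> walks H n"
          using img succ[of ws] by (auto simp: walks_def simp del: successively_map)
      qed
      show "walks H n \<subseteq> map h ` walks G n"
      proof
        fix ws assume ws: "ws \<in> walks H n"
        then have "ws \<in> lists (h ` pverts G)" by (auto simp: walks_def img)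
        then obtain vs where vs: "set vs \<subseteq> pverts G" "ws = map h vs"
          unfolding lists_image by auto
        then have "vs \<in> walks G n" using ws succ[of vs] by (simp add: walks_def)
        then show "ws \<in> map h ` walks G n" using vs by blast
      qed
    qed
  qed
  then show ?thesis by (rule bij_betw_same_card)
qed

section \<open>Cubes of subsets with some vertices removed\<close>

definition punctured_cube :: "nat \<Rightarrow> nat set set \<Rightarrow> nat set pair_pre_digraph" where
  "punctured_cube d X = \<lparr> pverts = Pow {..<d} - X,
     parcs = {(A, B). A \<in> Pow {..<d} - X \<and> B \<in> Pow {..<d} - X \<and> card (sym_diff A B) = 1} \<rparr>"

lemma wf_punctured_cube: "wf_digraph (with_proj (punctured_cube d X))"
  by unfold_locales (auto simp: punctured_cube_def)

lemma punctured_cube_iso: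
  assumes bij: "bij_betw h (Pow {..<d}) (Pow {..<d})"
    and dist: "\<And>A B. A \<subseteq> {..<d} \<Longrightarrow> B \<subseteq> {..<d} \<Longrightarrow>
      card (sym_diff (h A) (h B)) = card (sym_diff A B)"
    and X: "X \<subseteq> Pow {..<d}"
  shows "digraph_iso (with_proj (punctured_cube d X)) (with_proj (punctured_cube d (h ` X)))"
proof (rule digraph_iso_with_projI[OF wf_punctured_cube wf_punctured_cube])
  have "bij_betw h X (h ` X)"
    using bij X by (rule bij_betw_subset) simp
  moreover have "h ` X \<subseteq> Pow {..<d}"
    using image_mono[OF X, of h] bij_betw_imp_surj_on[OF bij] by simp
  ultimately have "bij_betw h (Pow {..<d} - X) (Pow {..<d} - h ` X)"
    using bij X by (intro bij_betw_DiffI)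
  then show bij': "bij_betw h (pverts (punctured_cube d X)) (pverts (punctured_cube d (h ` X)))"
    by (simp add: punctured_cube_def)
  fix A B
  assume "A \<in> pverts (punctured_cube d X)" "B \<in> pverts (punctured_cube d X)"
  moreover from this bij' have "h A \<in> pverts (punctured_cube d (h ` X))"
    "h B \<in> pverts (punctured_cube d (h ` X))"
    by (auto dest: bij_betwE)
  ultimately show "(A, B) \<in> parcs (punctured_cube d X) \<longleftrightarrow>
      (h A, h B) \<in> parcs (punctured_cube d (h ` X))"
    using dist by (auto simp: punctured_cube_def)
qed

text \<open>Symmetric difference with a fixed set preserves distances and is its own inverse.\<close>
lemma punctured_cube_iso_translate:
  assumes C: "C \<subseteq> {..<d}" and X: "X \<subseteq> Pow {..<d}"
  shows "digraph_iso (with_proj (punctured_cube d X))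
    (with_proj (punctured_cube d (sym_diff C ` X)))"
proof (rule punctured_cube_iso[OF _ _ X])
  show "bij_betw (sym_diff C) (Pow {..<d}) (Pow {..<d})"
    by (rule bij_betw_byWitness[where f' = "sym_diff C"]) (use C in auto)
  show "card (sym_diff (sym_diff C A) (sym_diff C B)) = card (sym_diff A B)" for A B
    by (rule arg_cong[of _ _ card]) auto
qed

lemma punctured_cube_iso_permute:
  assumes p: "bij_betw p {..<d} {..<d}" and X: "X \<subseteq> Pow {..<d}"
  shows "digraph_iso (with_proj (punctured_cube d X))
    (with_proj (punctured_cube d (image p ` X)))"
proof (rule punctured_cube_iso[OF _ _ X])
  show "bij_betw (image p) (Pow {..<d}) (Pow {..<d})"
    using p by (rule bij_betw_Pow)
  fix A B assume AB: "A \<subseteq> {..<d}" "B \<subseteq> {..<d}"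
  have inj: "inj_on p {..<d}" using p by (simp add: bij_betw_def)
  have "sym_diff (p ` A) (p ` B) = p ` sym_diff A B"
    using inj_on_image_set_diff[OF inj, of A B] inj_on_image_set_diff[OF inj, of B A] AB
    by (simp add: image_Un Diff_subset subset_trans[OF Diff_subset])
  moreover have "inj_on p (sym_diff A B)"
    using AB by (intro inj_on_subset[OF inj]) auto
  ultimately show "card (sym_diff (p ` A) (p ` B)) = card (sym_diff A B)"
    by (simp add: card_image)
qed

text \<open>These are the vertices of the two deleted edges. For empty \<open>S\<close>, which corresponds to a
  constant string, the edges share the vertex \<open>{}\<close>.\<close>
definition holes :: "nat \<Rightarrow> nat set \<Rightarrow> nat set set" where
  "holes d S = {{}, {0}} \<union> {S, insert (d - 1) S}"

text \<open>Besides mapping \<open>S\<close> to \<open>S'\<close>, the permutation of coordinates has to fix \<open>0\<close> and \<open>d - 1\<close>, the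
  directions of the deleted edges. This is possible because \<open>S\<close> and \<open>S'\<close> avoid both.\<close>
lemma punctured_cube_holes_iso:
  assumes d: "d \<ge> 2" and S: "S \<subseteq> {1..<d - 1}" and S': "S' \<subseteq> {1..<d - 1}"
    and card: "card S = card S'"
  shows "digraph_iso (with_proj (punctured_cube d (holes d S)))
    (with_proj (punctured_cube d (holes d S')))"
proof -
  define M where "M = {1..<d - 1}"
  have fin: "finite S" "finite S'" "finite M"
    using S S' by (auto simp: M_def intro: finite_subset)
  obtain p where p: "bij_betw p S S'"
    using finite_same_card_bij[OF fin(1,2) card] by blast
  have "card (M - S) = card (M - S')"
    using card S S' fin by (simp add: card_Diff_subset M_def)
  then obtain q where q: "bij_betw q (M - S) (M - S')"
    using finite_same_card_bij fin by (metis finite_Diff)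
  define r where "r i = (if i \<in> S then p i else if i \<in> M - S then q i else i)" for i
  have "bij_betw r S S'"
    by (rule bij_betw_cong[THEN iffD1, OF _ p]) (simp add: r_def)
  moreover have "bij_betw r (M - S) (M - S')"
    by (rule bij_betw_cong[THEN iffD1, OF _ q]) (simp add: r_def)
  moreover have "bij_betw r {0, d - 1} {0, d - 1}"
    by (rule bij_betw_cong[THEN iffD1, OF _ bij_betw_id]) (use S in \<open>auto simp: r_def M_def\<close>)
  ultimately have "bij_betw r (S \<union> (M - S) \<union> {0, d - 1}) (S' \<union> (M - S') \<union> {0, d - 1})"
    by (intro bij_betw_combine) (use S S' d in \<open>auto simp: M_def\<close>)
  moreover have "M \<union> {0, d - 1} = {..<d}" using d by (auto simp: M_def)
  then have "S \<union> (M - S) \<union> {0, d - 1} = {..<d}" "S' \<union> (M - S') \<union> {0, d - 1} = {..<d}"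
    using S S' by (auto simp: M_def Un_absorb1)
  ultimately have r: "bij_betw r {..<d} {..<d}" by simp
  have "r ` S = S'" using \<open>bij_betw r S S'\<close> by (simp add: bij_betw_def)
  moreover have "r 0 = 0" "r (d - 1) = d - 1" using S by (auto simp: r_def M_def)
  ultimately have "image r ` holes d S = holes d S'"
    by (simp add: holes_def)
  moreover have "S \<subseteq> {..<d}" using S by fastforce
  then have "holes d S \<subseteq> Pow {..<d}" using d by (auto simp: holes_def)
  ultimately show ?thesis using punctured_cube_iso_permute[OF r, of "holes d S"] by simp
qed

lemma walks_punctured_cube:
  "walks (punctured_cube d X) n = {ws \<in> walks (punctured_cube d {}) n. set ws \<inter> X = {}}"
proof -
  have "successively (\<lambda>A B. (A, B) \<in> parcs (punctured_cube d X)) ws \<longleftrightarrow>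
      successively (\<lambda>A B. (A, B) \<in> parcs (punctured_cube d {})) ws"
    if "set ws \<subseteq> Pow {..<d} - X" for ws
    by (rule successively_cong) (use that in \<open>auto simp: punctured_cube_def\<close>)
  then show ?thesis
    by (auto simp: walks_def) (auto simp: punctured_cube_def)
qed

section \<open>Counting walks in punctured cubes\<close>

lemma card_walks_inclusion_exclusion:
  fixes d n :: nat and X Y :: "nat set set"
  defines "N \<equiv> \<lambda>X. card (walks (punctured_cube d X) n)"
  shows "N (X \<union> Y) + N {} =
    N X + N Y + card {ws \<in> walks (punctured_cube d {}) n. set ws \<inter> X \<noteq> {} \<and> set ws \<inter> Y \<noteq> {}}"
proof -
  define W where "W = walks (punctured_cube d {}) n"
  define P where "P = {ws \<in> W. set ws \<inter> X = {}}"
  define Q where "Q = {ws \<in> W. set ws \<inter> Y = {}}"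
  define B where "B = {ws \<in> W. set ws \<inter> X \<noteq> {} \<and> set ws \<inter> Y \<noteq> {}}"
  have fin: "finite W" unfolding W_def by (rule finite_walks) (simp add: punctured_cube_def)
  have W: "W = (P \<union> Q) \<union> B" "(P \<union> Q) \<inter> B = {}" by (auto simp: P_def Q_def B_def)
  have "card W = card (P \<union> Q) + card B"
    using fin W by (metis card_Un_disjoint finite_Un)
  \<comment> \<open>\<open>P \<inter> Q\<close> consists of the walks that avoid \<open>X \<union> Y\<close>, and \<open>P \<union> Q\<close> of those that do not
    meet both \<open>X\<close> and \<open>Y\<close>.\<close>
  moreover have "card P + card Q = card (P \<union> Q) + card (P \<inter> Q)"
    by (rule card_Un_Int) (use fin in \<open>simp_all add: P_def Q_def\<close>)
  moreover have "N X = card P" "N Y = card Q" "N {} = card W"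
    unfolding N_def W_def P_def Q_def walks_punctured_cube[of d X n] walks_punctured_cube[of d Y n]
    by (rule refl)+
  moreover have "N (X \<union> Y) = card (P \<inter> Q)"
    unfolding N_def walks_punctured_cube[of d "X \<union> Y" n]
    by (rule arg_cong[of _ _ card]) (auto simp: P_def Q_def W_def)
  ultimately show ?thesis by (simp add: B_def W_def)
qed

text \<open>Each step changes one element, so by the triangle inequality two vertices on a walk are
  no further apart than its number of steps.\<close>
lemma card_sym_diff_le_walk_length:
  assumes "ws \<in> walks (punctured_cube d {}) n" and "A \<in> set ws" and "B \<in> set ws"
  shows "card (sym_diff A B) \<le> n"
proof -
  have tri: "card (sym_diff A C) \<le> card (sym_diff A B) + card (sym_diff B C)"
    if "A \<subseteq> {..<d}" "B \<subseteq> {..<d}" "C \<subseteq> {..<d}" for A B C :: "nat set"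
  proof -
    have "card (sym_diff A C) \<le> card (sym_diff A B \<union> sym_diff B C)"
      using that by (intro card_mono) (auto intro: finite_subset[of _ "{..<d}"])
    then show ?thesis using card_Un_le le_trans by blast
  qed
  from assms show ?thesis
  proof (induction n arbitrary: ws A B)
    case 0
    then show ?case by (auto simp: walks_def length_Suc_conv)
  next
    case (Suc n)
    obtain C vs where ws: "ws = C # vs" "length vs = Suc n"
      using Suc.prems(1) by (auto simp: walks_def length_Suc_conv)
    have vs: "vs \<in> walks (punctured_cube d {}) n" and step: "card (sym_diff C (hd vs)) = 1"
      using Suc.prems(1) ws by (cases vs; auto simp: walks_def punctured_cube_def)+
    have hd: "hd vs \<in> set vs" using ws by (cases vs) auto
    have sub: "D \<subseteq> {..<d}" if "D \<in> set ws" for D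
      using Suc.prems(1) that by (auto simp: walks_def punctured_cube_def)
    have far: "card (sym_diff C D) \<le> Suc n" if "D \<in> set vs" for D
      using tri[of C "hd vs" D] Suc.IH[OF vs hd that] step sub hd that ws by auto
    have swap: "sym_diff A B = sym_diff B A" by blast
    show ?case
      using Suc.prems(2,3) far Suc.IH[OF vs, of A B] swap ws by fastforce
  qed
qed

text \<open>Remove the elements of \<open>S\<close> one at a time.\<close>
lemma ex_walk_to_empty:
  assumes "finite S" and "S \<subseteq> {..<d}"
  shows "\<exists>ws \<in> walks (punctured_cube d {}) (card S). hd ws = S \<and> last ws = {}"
  using assms
proof (induction S)
  case empty
  have "[{}] \<in> walks (punctured_cube d {}) 0"
    by (simp add: walks_def punctured_cube_def)
  then show ?case by force
next
  case (insert x S)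
  then obtain ws where ws: "ws \<in> walks (punctured_cube d {}) (card S)" "hd ws = S" "last ws = {}"
    by auto
  have "sym_diff (insert x S) S = {x}" using insert by auto
  then have "(insert x S, S) \<in> parcs (punctured_cube d {})"
    using insert by (auto simp: punctured_cube_def)
  then have "insert x S # ws \<in> walks (punctured_cube d {}) (card (insert x S))"
    using ws insert by (auto simp: walks_def successively_Cons punctured_cube_def)
  moreover have "ws \<noteq> []" using ws(1) by (auto simp: walks_def)
  ultimately show ?case using ws(3) by (metis last_ConsR list.sel(1))
qed

text \<open>Walks with \<open>n = card S\<close> steps tell the two graphs apart: in the inclusion-exclusion formula
  the counts differ only in the walks that meet both deleted edges, and \<open>n\<close> steps suffice to get from one edge to the other for \<open>S\<close>, but not for \<open>S'\<close>.\<close>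
lemma punctured_cube_holes_not_iso:
  assumes d: "d \<ge> 2" and S: "S \<subseteq> {1..<d - 1}" and S': "S' \<subseteq> {1..<d - 1}"
    and less: "card S < card S'"
  shows "\<not> digraph_iso (with_proj (punctured_cube d (holes d S)))
    (with_proj (punctured_cube d (holes d S')))"
proof
  define n where "n = card S"
  define N where "N X = card (walks (punctured_cube d X) n)" for X
  define both where "both T = {ws \<in> walks (punctured_cube d {}) n.
    set ws \<inter> {{}, {0}} \<noteq> {} \<and> set ws \<inter> {T, insert (d - 1) T} \<noteq> {}}" for T
  have ie: "N (holes d T) + N {} = N {{}, {0}} + N {T, insert (d - 1) T} + card (both T)" for T
    unfolding holes_def N_def both_def by (rule card_walks_inclusion_exclusion)
  \<comment> \<open>The number of walks avoiding the second edge does not depend on \<open>T\<close>, as translation by \<open>T\<close>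
    moves that edge to a fixed place.\<close>
  have trans: "N {T, insert (d - 1) T} = N {{}, {d - 1}}" if "T \<subseteq> {1..<d - 1}" for T
  proof -
    have "sym_diff T ` {{}, {d - 1}} = {T, insert (d - 1) T}"
      using that by auto
    moreover have "T \<subseteq> {..<d}" using that by fastforce
    moreover have "{{}, {d - 1}} \<subseteq> Pow {..<d}" using d by auto
    ultimately have "digraph_iso (with_proj (punctured_cube d {{}, {d - 1}}))
        (with_proj (punctured_cube d {T, insert (d - 1) T}))"
      using punctured_cube_iso_translate[of T d "{{}, {d - 1}}"] by simp
    then show ?thesis unfolding N_def by (simp add: card_walks_iso)
  qed
  have "both S \<noteq> {}"
  proof -
    have "S \<subseteq> {..<d}" using S by fastforce
    then have "finite S" "S \<subseteq> {..<d}" by (auto intro: finite_subset)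
    then obtain ws where ws: "ws \<in> walks (punctured_cube d {}) n" "hd ws = S" "last ws = {}"
      using ex_walk_to_empty unfolding n_def by blast
    then have "ws \<noteq> []" by (auto simp: walks_def)
    then have "S \<in> set ws" "{} \<in> set ws" using ws hd_in_set last_in_set by metis+
    with ws show ?thesis unfolding both_def by blast
  qed
  moreover have "finite (both S)"
    unfolding both_def by (simp add: finite_walks punctured_cube_def)
  ultimately have "card (both S) > 0" by (simp add: card_gt_0_iff)
  moreover have "both S' = {}"
  proof (rule ccontr)
    assume "both S' \<noteq> {}"
    then obtain ws A B where ws: "ws \<in> walks (punctured_cube d {}) n" "A \<in> set ws" "B \<in> set ws"
      and A: "A \<in> {{}, {0}}" and B: "B \<in> {S', insert (d - 1) S'}"
      unfolding both_def by blast
    have "S' \<subseteq> {..<d}" using S' by fastforce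
    then have "A \<subseteq> {..<d}" "B \<subseteq> {..<d}"
      using A B d by auto
    then have "finite (sym_diff A B)"
      by (meson finite_Diff finite_UnI finite_lessThan finite_subset)
    \<comment> \<open>\<open>B\<close> contains \<open>S'\<close>, while \<open>A\<close> contains at most \<open>0\<close>, which is not in \<open>S'\<close>.\<close>
    moreover have "S' \<subseteq> sym_diff A B" using A B S' by auto
    ultimately have "card S' \<le> card (sym_diff A B)" by (rule card_mono)
    with card_sym_diff_le_walk_length[OF ws] less show False by (simp add: n_def)
  qed
  ultimately have "N (holes d S) \<noteq> N (holes d S')"
    using ie[of S] ie[of S'] trans[OF S] trans[OF S'] by simp
  moreover assume "digraph_iso (with_proj (punctured_cube d (holes d S)))
    (with_proj (punctured_cube d (holes d S')))"
  then have "N (holes d S) = N (holes d S')"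
    unfolding N_def by (rule card_walks_iso)
  ultimately show False by simp
qed

section \<open>Strings as sets of mismatches\<close>

definition changes :: "bool list \<Rightarrow> nat set" where
  "changes f = {i. 1 \<le> i \<and> i < length f \<and> f ! (i - 1) \<noteq> f ! i}"

definition mismatches :: "bool list \<Rightarrow> bool list \<Rightarrow> nat set" where
  "mismatches g w = {i. i < length g \<and> w ! i \<noteq> g ! i}"

lemma bij_betw_mismatches:
  "bij_betw (mismatches g) {w. length w = length g} (Pow {..<length g})"
proof (rule bij_betw_byWitness)
  let ?inv = "\<lambda>A. map (\<lambda>i. (g ! i) \<noteq> (i \<in> A)) [0..<length g]"
  show "\<forall>w \<in> {w. length w = length g}. ?inv (mismatches g w) = w"
    by (auto simp: mismatches_def intro!: nth_equalityI)
  show "\<forall>A \<in> Pow {..<length g}. mismatches g (?inv A) = A"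
    by (auto simp: mismatches_def)
qed (auto simp: mismatches_def)

lemma sublist_Suc_length_iff:
  assumes "length w = Suc (length f)"
  shows "sublist f w \<longleftrightarrow> tl w = f \<or> butlast w = f"
proof
  assume "sublist f w"
  then obtain ps ss where w: "w = ps @ f @ ss" by (auto simp: sublist_def)
  with assms have "length ps + length ss = 1" by simp
  then consider a where "ps = [a]" "ss = []" | a where "ps = []" "ss = [a]"
    by (cases ps; cases ss) auto
  then show "tl w = f \<or> butlast w = f" by cases (use w in auto)
next
  assume "tl w = f \<or> butlast w = f"
  then show "sublist f w" by (metis sublist_tl sublist_butlast)
qed

text \<open>The reference string repeats the first bit of \<open>f\<close> in front of \<open>f\<close>. A string \<open>w\<close> that ends
  in \<open>f\<close> can differ from it only at position \<open>0\<close>. If \<open>w\<close> starts with \<open>f\<close>, then at position \<open>i\<close>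
  the bit \<open>f ! i\<close> is compared with its predecessor in \<open>f\<close> (with itself for \<open>i = 0\<close>), so that up
  to the free last position the mismatches are exactly the changes of \<open>f\<close>.\<close>
lemma sublist_iff_mismatches:
  assumes f: "f \<noteq> []" and w: "length w = Suc (length f)"
  shows "sublist f w \<longleftrightarrow> mismatches (hd f # f) w \<in> holes (Suc (length f)) (changes f)"
proof -
  let ?D = "mismatches (hd f # f) w" and ?n = "length f"
  have "tl w = f \<longleftrightarrow> (\<forall>i < ?n. w ! Suc i = f ! i)"
    using w by (auto simp: list_eq_iff_nth_eq nth_tl)
  also have "\<dots> \<longleftrightarrow> ?D \<subseteq> {0}"
    by (auto simp: mismatches_def less_Suc_eq_0_disj)
  finally have near: "tl w = f \<longleftrightarrow> ?D = {} \<or> ?D = {0}" by (simp add: subset_singleton_iff)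
  have ch: "i \<in> changes f \<longleftrightarrow> f ! i \<noteq> (hd f # f) ! i" if "i < ?n" for i
    using that f by (cases i) (auto simp: changes_def hd_conv_nth)
  have "butlast w = f \<longleftrightarrow> (\<forall>i < ?n. w ! i = f ! i)"
    using w by (auto simp: list_eq_iff_nth_eq nth_butlast)
  also have "\<dots> \<longleftrightarrow> (\<forall>i < ?n. i \<in> ?D \<longleftrightarrow> i \<in> changes f)"
    using ch by (auto simp: mismatches_def)
  also have "\<dots> \<longleftrightarrow> ?D - {?n} = changes f"
  proof -
    have "?D \<subseteq> {..?n}" "changes f \<subseteq> {..<?n}" by (auto simp: mismatches_def changes_def)
    then have "i \<in> ?D - {?n} \<longleftrightarrow> i < ?n \<and> i \<in> ?D" "i \<in> changes f \<longleftrightarrow> i < ?n \<and> i \<in> changes f"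
      for i by force+
    then show ?thesis unfolding set_eq_iff by blast
  qed
  also have "\<dots> \<longleftrightarrow> ?D = changes f \<or> ?D = insert ?n (changes f)"
  proof -
    have "?n \<notin> changes f" by (simp add: changes_def)
    then show ?thesis by blast
  qed
  finally show ?thesis
    using near sublist_Suc_length_iff[OF w] unfolding holes_def diff_Suc_1 by blast
qed

lemma fibonacci_cube_iso_punctured_cube:
  assumes d: "d \<ge> 2" and f: "length f = d - 1"
  shows "digraph_iso (fibonacci_cube d f) (with_proj (punctured_cube d (holes d (changes f))))"
proof -
  define g where "g = hd f # f"
  define V where "V = {w :: bool list. length w = d \<and> \<not> sublist f w}"
  \<comment> \<open>The Fibonacci cube written with pairs as arcs.\<close>
  define G where "G = \<lparr>pverts = V,
    parcs = {(u, v). u \<in> V \<and> v \<in> V \<and> (\<exists>!i. i < d \<and> u ! i \<noteq> v ! i)}\<rparr>"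
  have g: "length g = d" using d f by (simp add: g_def)
  have G: "fibonacci_cube d f = with_proj G"
    by (auto simp: fibonacci_cube_def G_def V_def hypercube_def induce_subgraph_def with_proj_def)
  have wf: "wf_digraph (with_proj G)" by unfold_locales (auto simp: G_def)
  have bij: "bij_betw (mismatches g) V (Pow {..<d} - holes d (changes f))"
  proof -
    have "f \<noteq> []" "Suc (length f) = d" using d f by auto
    then have sub: "sublist f w \<longleftrightarrow> mismatches g w \<in> holes d (changes f)" if "length w = d" for w
      using sublist_iff_mismatches[of f w] that by (simp add: g_def)
    have all: "bij_betw (mismatches g) {w. length w = d} (Pow {..<d})"
      using bij_betw_mismatches[of g] by (simp add: g)
    show ?thesis
    proof (rule bij_betw_imageI)
      show "inj_on (mismatches g) V"
        using all by (auto simp: bij_betw_def V_def intro: inj_on_subset)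
      have "mismatches g ` V = mismatches g ` {w. length w = d} - holes d (changes f)"
        using sub by (auto simp: V_def)
      then show "mismatches g ` V = Pow {..<d} - holes d (changes f)"
        using all by (simp add: bij_betw_def)
    qed
  qed
  have single: "card {i. P i} = 1 \<longleftrightarrow> (\<exists>!i. P i)" for P :: "nat \<Rightarrow> bool"
    unfolding One_nat_def card_1_singleton_iff Ex1_def by (rule ex_cong1) auto
  have "(u, v) \<in> parcs G \<longleftrightarrow>
      (mismatches g u, mismatches g v) \<in> parcs (punctured_cube d (holes d (changes f)))"
    if "u \<in> V" "v \<in> V" for u v
  proof -
    have "sym_diff (mismatches g u) (mismatches g v) = {i. i < d \<and> u ! i \<noteq> v ! i}"
      by (auto simp: mismatches_def g)
    moreover have "card {i. i < d \<and> u ! i \<noteq> v ! i} = 1 \<longleftrightarrow> (\<exists>!i. i < d \<and> u ! i \<noteq> v ! i)"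
      by (rule single)
    moreover have "mismatches g u \<in> Pow {..<d} - holes d (changes f)"
      "mismatches g v \<in> Pow {..<d} - holes d (changes f)"
      using that bij by (auto dest: bij_betwE)
    ultimately show ?thesis using that by (simp add: G_def punctured_cube_def)
  qed
  with wf bij show ?thesis
    unfolding G
    by (intro digraph_iso_with_projI[OF _ wf_punctured_cube, where h = "mismatches g"])
      (simp_all add: G_def punctured_cube_def)
qed

theorem theorem3p1:
  fixes d :: nat and f f' :: "bool list"
  assumes "d \<ge> 2"
    and "length f = d - 1"
    and "length f' = d - 1"
  shows "nu f = nu f' \<longleftrightarrow> digraph_iso (fibonacci_cube d f) (fibonacci_cube d f')"
proof -
  let ?M = "\<lambda>f. with_proj (punctured_cube d (holes d (changes f)))"
  have iso: "digraph_iso (fibonacci_cube d f) (?M f)" "digraph_iso (fibonacci_cube d f') (?M f')"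
    using assms by (simp_all add: fibonacci_cube_iso_punctured_cube)
  have wf: "wf_digraph (fibonacci_cube d f)" for f
    using graph_fibonacci_cube[of d f] by (simp add: graph_def digraph_def fin_digraph_def)
  have wfM: "wf_digraph (?M f)" for f by (rule wf_punctured_cube)
  have S: "changes f \<subseteq> {1..<d - 1}" "changes f' \<subseteq> {1..<d - 1}"
    using assms by (auto simp: changes_def)
  have nu: "nu f = card (changes f)" for f
    by (simp add: nu_conv_card_changes changes_def)
  have "digraph_iso (fibonacci_cube d f) (fibonacci_cube d f') \<longleftrightarrow> digraph_iso (?M f) (?M f')"
    using iso wf wfM by (meson digraph_iso_swap digraph_iso_trans)
  also have "\<dots> \<longleftrightarrow> card (changes f) = card (changes f')"
  proof
    assume "card (changes f) = card (changes f')"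
    then show "digraph_iso (?M f) (?M f')"
      by (rule punctured_cube_holes_iso[OF assms(1) S])
  next
    assume M: "digraph_iso (?M f) (?M f')"
    then have "digraph_iso (?M f') (?M f)" by (rule digraph_iso_swap[OF wfM])
    with M show "card (changes f) = card (changes f')"
      using punctured_cube_holes_not_iso[OF assms(1)] S by (metis linorder_neqE_nat)
  qed
  finally show ?thesis by (simp add: nu)
qed

end
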